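(* Let $\mathcal{K}$ be a field, let $n\ge 1$ and $r$ be integers with $5\le r\le 2n+5$, and let $\mathcal{R}=\mathcal{K}[\mathcal{M}]\subseteq \mathcal{K}[s,t]$ be the monomial ring attached to $(n,r)$ in the context. Then (i) $\mathcal{R}$ is Cohen-Macaulay if $r$ is odd and $2n\ge r+1$; (ii) $\mathcal{R}$ is non-Cohen-Macaulay Buchsbaum if $r$ is odd and $2n<r+1$; (iii) $\mathcal{R}$ is non-Cohen-Macaulay Buchsbaum if $r$ is even.
   Context: Let $\mathcal{K}$ be a field. For integers $n\ge 1$ and $r\ge 5$ put $b_1=r$, $b_2=2r-2$ and $a_i=2r+2i-1$ for $0\le i\le n$. Let $$\mathcal{M}=\{s^{a_n},\ s^{a_n-b_1}t^{b_1},\ s^{a_n-b_2}t^{b_2},\ s^{a_n-a_0}t^{a_0},\ s^{a_n-a_1}t^{a_1},\dots,s^{a_n-a_{n-1}}t^{a_{n-1}},\ t^{a_n}\}\subset\mathcal{K}[s,t],$$ and let $\mathcal{R}=\mathcal{K}[\mathcal{M}]$ be the $\mathcal{K}$-subalgebra of $\mathcal{K}[s,t]$ generated by $\mathcal{M}$, with homogeneous maximal ideal $\mathfrak{m}=(\mathcal{M})\mathcal{R}$. Such a two-dimensional monomial ring is Cohen-Macaulay if the local cohomology module $H^1_{\mathfrak{m}}(\mathcal{R})$ is $0$, and is Buchsbaum if $\mathfrak{m}H^1_{\mathfrak{m}}(\mathcal{R})=0$. *)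

theory Defs
  imports
    "HOL-Computational_Algebra.Computational_Algebra"
    "HOL-Library.Set_Algebras"
    "HOL-Library.Function_Algebras"
begin

(* K[s,t] is rendered as K[s][t], the type 'k poly poly: the outer variable is t. *)

definition mon :: "nat \<Rightarrow> nat \<Rightarrow> 'k::field poly poly" where
  "mon i j = monom (monom 1 i) j"  (* s^i t^j *)

definition is_subalgebra :: "'k::field poly poly set \<Rightarrow> bool" where
  "is_subalgebra A \<longleftrightarrow>
     (\<forall>c. [:[:c:]:] \<in> A) \<and> (\<forall>p\<in>A. \<forall>q\<in>A. p + q \<in> A \<and> p * q \<in> A)"

definition generated_subalgebra :: "'k::field poly poly set \<Rightarrow> 'k poly poly set" where
  "generated_subalgebra G = is_subalgebra hull G"

definition is_ideal :: "'a::comm_ring_1 set \<Rightarrow> 'a set \<Rightarrow> bool" where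
  "is_ideal R I \<longleftrightarrow> I \<subseteq> R \<and> 0 \<in> I \<and> (\<forall>x\<in>I. \<forall>y\<in>I. x + y \<in> I) \<and> (\<forall>a\<in>R. \<forall>x\<in>I. a * x \<in> I)"

definition generated_ideal :: "'a::comm_ring_1 set \<Rightarrow> 'a set \<Rightarrow> 'a set" where
  "generated_ideal R G = is_ideal R hull G"

(* First local cohomology of a subring R of a domain with support in the ideal (G)R, for a finite
   set G of nonzero elements of R: the degree-one cohomology of the Cech complex
     R \<rightarrow> \<Prod>_{g in G} R_g \<rightarrow> \<Prod>_{g,h in G} R_{gh}.
   As R is a domain, all localisations are taken inside a common field of fractions, so that
   the localisation maps are inclusions.  Products over G are functions vanishing outside G.
   Using all pairs (g,h) instead of ordered ones does not change the kernel in degree one. *)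

definition localization :: "'a::idom set \<Rightarrow> 'a \<Rightarrow> 'a fract set" where
  "localization R x = {to_fract a / to_fract x ^ k | a k. a \<in> R}"

definition cech_C1 :: "'a::idom set \<Rightarrow> 'a set \<Rightarrow> ('a \<Rightarrow> 'a fract) set" where
  "cech_C1 R G = {f. (\<forall>g\<in>G. f g \<in> localization R g) \<and> (\<forall>g. g \<notin> G \<longrightarrow> f g = 0)}"

definition cech_d0 :: "'a::idom set \<Rightarrow> 'a \<Rightarrow> ('a \<Rightarrow> 'a fract)" where
  "cech_d0 G a = (\<lambda>g. if g \<in> G then to_fract a else 0)"

definition cech_d1 :: "'a::idom set \<Rightarrow> ('a \<Rightarrow> 'a fract) \<Rightarrow> ('a \<times> 'a \<Rightarrow> 'a fract)" where
  "cech_d1 G f = (\<lambda>(g, h). if g \<in> G \<and> h \<in> G then f h - f g else 0)"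

definition cech_Z1 :: "'a::idom set \<Rightarrow> 'a set \<Rightarrow> ('a \<Rightarrow> 'a fract) set" where
  "cech_Z1 R G = {f \<in> cech_C1 R G. cech_d1 G f = 0}"

definition cech_B1 :: "'a::idom set \<Rightarrow> 'a set \<Rightarrow> ('a \<Rightarrow> 'a fract) set" where
  "cech_B1 R G = cech_d0 G ` R"

(* The R-module Z1/B1: its elements are the cosets f + B1, its zero is the coset B1. *)

definition local_cohomology1 :: "'a::idom set \<Rightarrow> 'a set \<Rightarrow> ('a \<Rightarrow> 'a fract) set set" where
  "local_cohomology1 R G = (\<lambda>f. f +o cech_B1 R G) ` cech_Z1 R G"

definition local_cohomology1_scale ::
    "'a::idom set \<Rightarrow> 'a set \<Rightarrow> 'a \<Rightarrow> ('a \<Rightarrow> 'a fract) set \<Rightarrow> ('a \<Rightarrow> 'a fract) set" where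
  "local_cohomology1_scale R G a X = (\<lambda>f g. to_fract a * f g) ` X + cech_B1 R G"

lemma local_cohomology1_scale_coset:
  assumes "0 \<in> R" and add: "\<And>x y. x \<in> R \<Longrightarrow> y \<in> R \<Longrightarrow> x + y \<in> R"
    and mult: "\<And>x y. x \<in> R \<Longrightarrow> y \<in> R \<Longrightarrow> x * y \<in> R" and "a \<in> R"
  shows "local_cohomology1_scale R G a (f +o cech_B1 R G)
           = (\<lambda>g. to_fract a * f g) +o cech_B1 R G"  (is "?L = ?r +o _")
proof
  have 1: "(\<lambda>g. to_fract a * (f + cech_d0 G x) g) + cech_d0 G y = ?r + cech_d0 G (a * x + y)" for x y
    by (auto simp: cech_d0_def fun_eq_iff algebra_simps)
  show "?L \<subseteq> ?r +o cech_B1 R G"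
  proof
    fix u assume "u \<in> ?L"
    then obtain x y where xy: "x \<in> R" "y \<in> R"
        "u = (\<lambda>g. to_fract a * (f + cech_d0 G x) g) + cech_d0 G y"
      by (auto simp: local_cohomology1_scale_def elt_set_plus_def set_plus_def cech_B1_def)
    with assms show "u \<in> ?r +o cech_B1 R G"
      unfolding 1 by (auto simp: cech_B1_def)
  qed
  show "?r +o cech_B1 R G \<subseteq> ?L"
  proof
    fix u assume "u \<in> ?r +o cech_B1 R G"
    then obtain y where y: "y \<in> R" "u = ?r + cech_d0 G y"
      by (auto simp: elt_set_plus_def cech_B1_def)
    have "f + cech_d0 G 0 \<in> f +o cech_B1 R G" "cech_d0 G y \<in> cech_B1 R G"
      using \<open>0 \<in> R\<close> y by (auto simp: cech_B1_def)
    then have "(\<lambda>g. to_fract a * (f + cech_d0 G 0) g) + cech_d0 G y \<in> ?L"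
      unfolding local_cohomology1_scale_def by (intro set_plus_intro imageI)
    then show "u \<in> ?L"
      unfolding 1 y(2) by simp
  qed
qed

(* For the two-dimensional monomial ring R = K[G], with homogeneous maximal ideal m = (G)R. *)

definition cohen_macaulay :: "'k::field poly poly set \<Rightarrow> bool" where
  "cohen_macaulay G \<longleftrightarrow>
     (let R = generated_subalgebra G in local_cohomology1 R G = {cech_B1 R G})"

definition buchsbaum :: "'k::field poly poly set \<Rightarrow> bool" where
  "buchsbaum G \<longleftrightarrow>
     (let R = generated_subalgebra G; m = generated_ideal R G in
        \<forall>a\<in>m. \<forall>X\<in>local_cohomology1 R G. local_cohomology1_scale R G a X = cech_B1 R G)"

definition a_exp :: "nat \<Rightarrow> nat \<Rightarrow> nat" where
  "a_exp r i = 2 * r + 2 * i - 1"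

(* No subtraction truncates when r \<ge> 1. *)
definition monomials :: "nat \<Rightarrow> nat \<Rightarrow> 'k::field poly poly set" where
  "monomials n r =
     (let N = a_exp r n; b1 = r; b2 = 2 * r - 2 in
        {mon N 0, mon (N - b1) b1, mon (N - b2) b2}
        \<union> {mon (N - a_exp r i) (a_exp r i) | i. i < n}
        \<union> {mon 0 N})"

end

theory Submission
  imports Defs
begin

text \<open>
  A cocycle of the Cech complex is one fraction \<open>\<phi>\<close> lying in every localisation of \<open>R\<close> at a generator,
  so \<open>H\<^sup>1\<close> is the quotient of these fractions (the sections of the structure sheaf away from the
  maximal ideal) by \<open>R\<close>.  As \<open>\<phi>\<close> has both a power of \<open>s\<close> and a power of \<open>t\<close> as a denominator, it is a
  polynomial, and everything becomes a question about the exponents of its monomials.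

  Let \<open>E\<close> be the set of \<open>t\<close>-exponents of the generators, \<open>N\<close> its maximum.  A monomial of degree \<open>d N\<close>
  with \<open>t\<close>-exponent \<open>j\<close> lies in \<open>R\<close> iff \<open>j\<close> is a sum of \<open>d\<close> elements of \<open>E\<close>.  If it occurs in a
  section \<open>\<phi>\<close>, then \<open>j\<close> is a sum of some number of elements of \<open>E\<close>, and \<open>d N - j\<close> is a sum of elements
  of \<open>N - E\<close>, which forces it to be even or at least \<open>2 n + 1\<close>.  Call such pairs \<open>(d, j)\<close> saturated.

  Every saturated pair belongs to \<open>R\<close>, except possibly \<open>(2, 3 r)\<close> (\<open>saturation_cases\<close>).
  In degree at least 3 this holds because sums of three elements of \<open>E\<close> reach every number from
  \<open>4 r\<close> on, up to bounds that depend on its parity; here \<open>r \<le> 2 n + 5\<close> closes the gaps.  Hence a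
  generator multiplies every section into \<open>R\<close>: the only possibly missing monomial has degree 2, and its
  multiples have degree 3.  So \<open>R\<close> is always Buchsbaum.  It is Cohen-Macaulay iff \<open>3 r\<close> is a sum
  of two elements of \<open>E\<close>, and the only way to achieve this is \<open>0 + 3 r\<close> with \<open>3 r\<close> an odd element
  of \<open>E\<close>, that is, \<open>r\<close> odd and \<open>3 r \<le> N\<close>.
\<close>

section \<open>Supports of polynomials in two variables\<close>

definition support :: "'k::field poly poly \<Rightarrow> (nat \<times> nat) set" where
  "support p = {(i, j). coeff (coeff p j) i \<noteq> 0}"

lemma coeff_coeff_mon: "coeff (coeff (mon a b) j) i = (if i = a \<and> j = b then 1 else 0)"
  by (auto simp: mon_def coeff_monom)

lemma support_mon: "support (mon a b :: 'k::field poly poly) = {(a, b)}"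
  by (auto simp: support_def coeff_coeff_mon split: if_splits)

lemma support_add: "support (p + q) \<subseteq> support p \<union> support q"
  by (auto simp: support_def)

lemma support_mult:
  "support (p * q) \<subseteq> {(i + i', j + j') | i j i' j'. (i, j) \<in> support p \<and> (i', j') \<in> support q}"
proof
  fix u assume "u \<in> support (p * q)"
  then obtain i j where u: "u = (i, j)" and "coeff (coeff (p * q) j) i \<noteq> 0"
    by (auto simp: support_def)
  then have "(\<Sum>b\<le>j. \<Sum>a\<le>i. coeff (coeff p b) a * coeff (coeff q (j - b)) (i - a)) \<noteq> 0"
    by (simp add: coeff_mult coeff_sum)
  then obtain b where b: "b \<le> j"
    and "(\<Sum>a\<le>i. coeff (coeff p b) a * coeff (coeff q (j - b)) (i - a)) \<noteq> 0"
    by (metis (no_types, lifting) atMost_iff sum.neutral)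
  then obtain a where a: "a \<le> i" and "coeff (coeff p b) a * coeff (coeff q (j - b)) (i - a) \<noteq> 0"
    by (metis (no_types, lifting) atMost_iff sum.neutral)
  then have "(a, b) \<in> support p" "(i - a, j - b) \<in> support q"
    by (auto simp: support_def)
  moreover have "u = (a + (i - a), b + (j - b))"
    using u a b by simp
  ultimately show "u \<in> {(i + i', j + j') | i j i' j'. (i, j) \<in> support p \<and> (i', j') \<in> support q}"
    by blast
qed

lemma coeff_coeff_mult_mon:
  "coeff (coeff (p * mon a b) j) i =
     (if a \<le> i \<and> b \<le> j then coeff (coeff p (j - b)) (i - a) else 0)"
  by (simp add: mon_def mult.commute[of p] mult.commute[of _ "monom 1 a"] coeff_monom_mult)

lemma support_mult_mon: "(i, j) \<in> support p \<Longrightarrow> (i + a, j + b) \<in> support (p * mon a b)"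
  by (simp add: support_def coeff_coeff_mult_mon)

lemma poly_poly_eq_sum_mon:
  "p = (\<Sum>j\<le>degree p. \<Sum>i\<le>degree (coeff p j). [:[:coeff (coeff p j) i:]:] * mon i j)"
proof -
  have *: "[:[:c:]:] * mon i j = monom (monom c i) j" for c :: 'a and i j
    by (simp add: mon_def smult_monom)
  have "(\<Sum>j\<le>degree p. \<Sum>i\<le>degree (coeff p j). [:[:coeff (coeff p j) i:]:] * mon i j)
      = (\<Sum>j\<le>degree p. monom (\<Sum>i\<le>degree (coeff p j). monom (coeff (coeff p j) i) i) j)"
    unfolding * by (simp add: monom_sum)
  also have "\<dots> = p"
    by (simp add: poly_as_sum_of_monoms)
  finally show ?thesis by simp
qed

lemma mon_mult: "mon a b * mon c d = mon (a + c) (b + d)"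
  by (simp add: mon_def mult_monom)

lemma mon_power: "mon a b ^ k = mon (k * a) (k * b)"
  by (simp add: mon_def monom_power mult.commute)

lemma mon_nonzero: "mon a b \<noteq> 0"
  by (simp add: mon_def monom_eq_0_iff)

section \<open>Subalgebras generated by monomials of equal degree\<close>

primrec sumset :: "nat set \<Rightarrow> nat \<Rightarrow> nat set" where
  "sumset E 0 = {0}"
| "sumset E (Suc d) = {x + y | x y. x \<in> E \<and> y \<in> sumset E d}"

definition graded_monoid :: "nat \<Rightarrow> nat set \<Rightarrow> (nat \<times> nat) set" where
  "graded_monoid N E = {(i, j). \<exists>d. i + j = d * N \<and> j \<in> sumset E d}"

lemma sumset_add: "x \<in> sumset E c \<Longrightarrow> y \<in> sumset E d \<Longrightarrow> x + y \<in> sumset E (c + d)"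
proof (induction c arbitrary: x)
  case (Suc c)
  then obtain u v where "x = u + v" "u \<in> E" "v \<in> sumset E c" by auto
  with Suc show ?case by (auto simp: add.assoc)
qed simp

lemma sumset_1: "sumset E (Suc 0) = E"
  by auto

text \<open>
  Padding with \<open>0\<close> turns at most \<open>d\<close> summands into exactly \<open>d\<close> summands.  In the ring, this is
  multiplication by a pure power of \<open>s\<close>.
\<close>

lemma sumset_mono:
  assumes "0 \<in> E" "x \<in> sumset E c" "c \<le> d"
  shows "x \<in> sumset E d"
proof -
  have "0 \<in> sumset E k" for k
    using assms(1) by (induction k) auto
  then have "x + 0 \<in> sumset E (c + (d - c))"
    using assms by (intro sumset_add)
  with assms show ?thesis by simp
qed

definition semigroup_ring :: "(nat \<times> nat) set \<Rightarrow> 'k::field poly poly set" where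
  "semigroup_ring S = {p. support p \<subseteq> S}"

lemma is_subalgebra_semigroup_ring:
  assumes "(0, 0) \<in> S"
    and "\<And>i j i' j'. (i, j) \<in> S \<Longrightarrow> (i', j') \<in> S \<Longrightarrow> (i + i', j + j') \<in> S"
  shows "is_subalgebra (semigroup_ring S :: 'k::field poly poly set)"
  unfolding is_subalgebra_def semigroup_ring_def
proof (intro conjI allI ballI; (unfold mem_Collect_eq)?)
  fix c show "support [:[:c:]:] \<subseteq> S"
    using assms(1) by (auto simp: support_def coeff_pCons' split: if_splits)
next
  fix p q :: "'k poly poly"
  assume "support p \<subseteq> S" "support q \<subseteq> S"
  then show "support (p + q) \<subseteq> S" "support (p * q) \<subseteq> S"
    using support_add[of p q] support_mult[of p q] assms(2) by blast+
qed

lemma generators_in_generated_subalgebra: "G \<subseteq> generated_subalgebra G"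
  unfolding generated_subalgebra_def by (rule hull_subset)

lemma is_subalgebra_generated: "is_subalgebra (generated_subalgebra G)"
  unfolding generated_subalgebra_def
  by (rule hull_in) (auto simp: is_subalgebra_def)

lemma is_subalgebraD:
  assumes "is_subalgebra A"
  shows "[:[:c:]:] \<in> A" "p \<in> A \<Longrightarrow> q \<in> A \<Longrightarrow> p + q \<in> A" "p \<in> A \<Longrightarrow> q \<in> A \<Longrightarrow> p * q \<in> A"
  using assms by (auto simp: is_subalgebra_def)

lemma is_subalgebra_sum:
  assumes "is_subalgebra A" "\<And>x. x \<in> X \<Longrightarrow> f x \<in> A"
  shows "sum f X \<in> A"
proof -
  have "0 \<in> A"
    using assms(1) unfolding is_subalgebra_def by (metis pCons_0_0)
  then show ?thesis
    using assms by (induction X rule: infinite_finite_induct) (auto simp: is_subalgebra_def)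
qed

text \<open>
  The total degree of a monomial tells how many generators a product has, so only the second exponents
  need to be written as sums; the first exponents are then correct automatically.
\<close>

lemma generated_subalgebra_monomials:
  assumes "\<And>e. e \<in> E \<Longrightarrow> e \<le> N"
  shows "generated_subalgebra {mon (N - e) e | e. e \<in> E}
    = (semigroup_ring (graded_monoid N E) :: 'k::field poly poly set)"
    (is "generated_subalgebra ?G = _")
proof
  have mem: "mon i j \<in> generated_subalgebra ?G" if "i + j = d * N" "j \<in> sumset E d" for i j d
    using that
  proof (induction d arbitrary: i j)
    case 0
    then have "mon i j = ([:[:1:]:] :: 'k poly poly)"
      by (simp add: mon_def one_pCons monom_0)
    then show ?case
      using is_subalgebraD(1)[OF is_subalgebra_generated, of 1 ?G] by simp
  next
    case (Suc d)
    then obtain e y where ey: "j = e + y" "e \<in> E" "y \<in> sumset E d" by auto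
    have bound: "y \<le> d * N" using ey(3)
      by (induction d arbitrary: y) (auto intro!: add_mono assms)
    have "(mon (d * N - y) y :: 'k poly poly) \<in> generated_subalgebra ?G"
      using bound ey by (intro Suc.IH) auto
    moreover have "(mon (N - e) e :: 'k poly poly) \<in> generated_subalgebra ?G"
      using ey generators_in_generated_subalgebra[of ?G] by auto
    moreover have "mon i j = (mon (N - e) e * mon (d * N - y) y :: 'k poly poly)"
    proof -
      have "i = N - e + (d * N - y)"
        using Suc.prems(1) ey assms[OF ey(2)] bound by auto
      then show ?thesis using ey by (simp add: mon_mult)
    qed
    ultimately show ?case
      using is_subalgebraD(3)[OF is_subalgebra_generated] by simp
  qed
  show "semigroup_ring (graded_monoid N E) \<subseteq> generated_subalgebra ?G"
  proof
    fix p :: "'k poly poly" assume p: "p \<in> semigroup_ring (graded_monoid N E)"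
    have "[:[:coeff (coeff p j) i:]:] * mon i j \<in> generated_subalgebra ?G" for i j
    proof (cases "coeff (coeff p j) i = 0")
      case True
      then show ?thesis
        using is_subalgebra_sum[OF is_subalgebra_generated[of ?G], of "{}"] by simp
    next
      case False
      then have "(i, j) \<in> graded_monoid N E"
        using p by (auto simp: semigroup_ring_def support_def)
      then have "(mon i j :: 'k poly poly) \<in> generated_subalgebra ?G"
        using mem by (auto simp: graded_monoid_def)
      then show ?thesis
        using is_subalgebra_generated[of ?G] unfolding is_subalgebra_def by blast
    qed
    then show "p \<in> generated_subalgebra ?G"
      by (subst poly_poly_eq_sum_mon) (intro is_subalgebra_sum is_subalgebra_generated)
  qed
  show "generated_subalgebra ?G \<subseteq> semigroup_ring (graded_monoid N E)"
    unfolding generated_subalgebra_def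
  proof (rule hull_minimal)
    show "?G \<subseteq> semigroup_ring (graded_monoid N E)"
      using assms by (fastforce simp: semigroup_ring_def support_mon graded_monoid_def sumset_1
        intro!: exI[of _ "Suc 0"])
    show "is_subalgebra (semigroup_ring (graded_monoid N E))"
    proof (rule is_subalgebra_semigroup_ring)
      show "(0, 0) \<in> graded_monoid N E"
        by (auto simp: graded_monoid_def intro!: exI[of _ 0])
      fix i j i' j' assume "(i, j) \<in> graded_monoid N E" "(i', j') \<in> graded_monoid N E"
      then obtain c d where "i + j = c * N" "j \<in> sumset E c" "i' + j' = d * N" "j' \<in> sumset E d"
        by (auto simp: graded_monoid_def)
      then show "(i + i', j + j') \<in> graded_monoid N E"
        by (auto simp: graded_monoid_def distrib_right intro!: exI[of _ "c + d"] sumset_add)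
    qed
  qed
qed

section \<open>First local cohomology through sections on the punctured spectrum\<close>

text \<open>
  These are the sections of the structure sheaf on the complement of the closed set defined by \<open>G\<close>,
  seen inside the field of fractions.
\<close>

definition punctured_sections :: "'a::idom set \<Rightarrow> 'a set \<Rightarrow> 'a fract set" where
  "punctured_sections R G = (\<Inter>g\<in>G. localization R g)"

text \<open>
  All localisations lie in one field, so the cocycle condition says that the components are equal.
\<close>

lemma cech_Z1_eq:
  assumes "G \<noteq> {}"
  shows "cech_Z1 R G = (\<lambda>\<phi> g. if g \<in> G then \<phi> else 0) ` punctured_sections R G"
proof (intro equalityI subsetI)
  fix f assume f: "f \<in> cech_Z1 R G"
  obtain g0 where g0: "g0 \<in> G" using assms by auto
  have const: "f g = f g0" if "g \<in> G" for g
  proof -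
    have "cech_d1 G f (g0, g) = 0" using f by (simp add: cech_Z1_def)
    then show ?thesis using that g0 by (simp add: cech_d1_def)
  qed
  have "f g0 \<in> localization R g" if "g \<in> G" for g
    using f const[OF that] that by (auto simp: cech_Z1_def cech_C1_def)
  then have "f g0 \<in> punctured_sections R G"
    by (auto simp: punctured_sections_def)
  moreover have "f = (\<lambda>g. if g \<in> G then f g0 else 0)"
    using f const by (auto simp: fun_eq_iff cech_Z1_def cech_C1_def)
  ultimately show "f \<in> (\<lambda>\<phi> g. if g \<in> G then \<phi> else 0) ` punctured_sections R G" by blast
next
  fix f assume "f \<in> (\<lambda>\<phi> g. if g \<in> G then \<phi> else 0) ` punctured_sections R G"
  then show "f \<in> cech_Z1 R G"
    by (auto simp: cech_Z1_def cech_C1_def cech_d1_def punctured_sections_def fun_eq_iff)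
qed

lemma cech_B1_iff:
  assumes "G \<noteq> {}"
  shows "(\<lambda>g. if g \<in> G then \<phi> else 0) \<in> cech_B1 R G \<longleftrightarrow> \<phi> \<in> to_fract ` R"
  using assms by (auto simp: cech_B1_def cech_d0_def fun_eq_iff image_iff)

lemma is_subalgebra_diff:
  assumes "is_subalgebra A" "p \<in> A" "q \<in> A"
  shows "p - q \<in> A"
proof -
  have "p + [:[:- 1:]:] * q \<in> A"
    using assms unfolding is_subalgebra_def by blast
  moreover have "[:[:- 1:]:] = (- 1 :: 'a poly poly)"
    by (simp add: one_pCons)
  ultimately show ?thesis by simp
qed

lemma is_subalgebra_0: "is_subalgebra A \<Longrightarrow> 0 \<in> A"
  using is_subalgebra_sum[of A "{}"] by simp

lemma coset_cech_B1:
  assumes R: "is_subalgebra R"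
  shows "f +o cech_B1 R G = cech_B1 R G \<longleftrightarrow> f \<in> cech_B1 R G"
proof
  have "cech_d0 G (0 :: 'a poly poly) = 0"
    by (auto simp: cech_d0_def fun_eq_iff)
  then have 0: "0 \<in> cech_B1 R G"
    unfolding cech_B1_def using is_subalgebra_0[OF R] by (metis imageI)
  assume "f +o cech_B1 R G = cech_B1 R G"
  then show "f \<in> cech_B1 R G"
    using set_plus_intro2[OF 0, of f] by simp
next
  assume "f \<in> cech_B1 R G"
  then obtain a where a: "a \<in> R" "f = cech_d0 G a" by (auto simp: cech_B1_def)
  have add: "cech_d0 G x + cech_d0 G y = cech_d0 G (x + y)" for x y :: "'a poly poly"
    by (auto simp: cech_d0_def fun_eq_iff)
  show "f +o cech_B1 R G = cech_B1 R G"
  proof (intro equalityI subsetI)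
    fix u assume "u \<in> f +o cech_B1 R G"
    then show "u \<in> cech_B1 R G"
      using a R by (auto simp: cech_B1_def elt_set_plus_def add is_subalgebra_def)
  next
    fix u assume "u \<in> cech_B1 R G"
    then obtain y where y: "y \<in> R" "u = cech_d0 G y" by (auto simp: cech_B1_def)
    have "u = f + cech_d0 G (y - a)"
      by (simp add: y a add)
    then show "u \<in> f +o cech_B1 R G"
      using is_subalgebra_diff[OF R y(1) a(1)] by (auto simp: cech_B1_def elt_set_plus_def)
  qed
qed

lemma cohen_macaulay_iff:
  assumes "G \<noteq> {}"
  shows "cohen_macaulay G \<longleftrightarrow>
    punctured_sections (generated_subalgebra G) G \<subseteq> to_fract ` generated_subalgebra G"
proof -
  define R where "R = generated_subalgebra G"
  have R: "is_subalgebra R" unfolding R_def by (rule is_subalgebra_generated)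
  have "0 \<in> R" by (rule is_subalgebra_0[OF R])
  then have "(0 :: 'a poly poly fract) \<in> punctured_sections R G"
    by (auto simp: punctured_sections_def localization_def intro!: exI[of _ 0])
  then have "cech_Z1 R G \<noteq> {}"
    unfolding cech_Z1_eq[OF assms] by blast
  then have "local_cohomology1 R G = {cech_B1 R G}
      \<longleftrightarrow> (\<forall>f\<in>cech_Z1 R G. f +o cech_B1 R G = cech_B1 R G)"
    by (auto simp: local_cohomology1_def)
  also have "\<dots> \<longleftrightarrow> (\<forall>\<phi>\<in>punctured_sections R G. \<phi> \<in> to_fract ` R)"
    unfolding coset_cech_B1[OF R] cech_B1_iff[OF assms, symmetric]
    by (simp add: cech_Z1_eq[OF assms])
  finally show ?thesis
    by (simp add: cohen_macaulay_def Let_def R_def subset_eq)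
qed

text \<open>
  The elements of \<open>R\<close> that multiply every section into \<open>R\<close> form an ideal, so it is enough to test the
  generators of the maximal ideal.
\<close>

lemma buchsbaumI:
  assumes "G \<noteq> {}"
    and mult: "\<And>g \<phi>. g \<in> G \<Longrightarrow> \<phi> \<in> punctured_sections (generated_subalgebra G) G
      \<Longrightarrow> to_fract g * \<phi> \<in> to_fract ` generated_subalgebra G"
  shows "buchsbaum G"
proof -
  define R where "R = generated_subalgebra G"
  have R: "is_subalgebra R" unfolding R_def by (rule is_subalgebra_generated)
  have R0: "0 \<in> R" by (rule is_subalgebra_0[OF R])
  define I where "I = {a \<in> R. \<forall>\<phi>\<in>punctured_sections R G. to_fract a * \<phi> \<in> to_fract ` R}"
  have "is_ideal R I"
    unfolding is_ideal_def
  proof (intro conjI ballI)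
    show "I \<subseteq> R" "0 \<in> I"
      using R0 by (auto simp: I_def image_iff intro!: bexI[of _ 0])
    fix x assume x: "x \<in> I"
    show "x + y \<in> I" if y: "y \<in> I" for y
      unfolding I_def
    proof (intro CollectI conjI ballI)
      show "x + y \<in> R" using x y R by (auto simp: I_def is_subalgebra_def)
      fix \<phi> assume "\<phi> \<in> punctured_sections R G"
      then obtain u v where "u \<in> R" "v \<in> R" "to_fract x * \<phi> = to_fract u" "to_fract y * \<phi> = to_fract v"
        using x y unfolding I_def by blast
      then have "to_fract (x + y) * \<phi> = to_fract (u + v)" "u + v \<in> R"
        using R by (auto simp: distrib_right is_subalgebra_def)
      then show "to_fract (x + y) * \<phi> \<in> to_fract ` R" by (simp only: imageI)
    qed
    show "a * x \<in> I" if a: "a \<in> R" for a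
      unfolding I_def
    proof (intro CollectI conjI ballI)
      show "a * x \<in> R" using x a R by (auto simp: I_def is_subalgebra_def)
      fix \<phi> assume "\<phi> \<in> punctured_sections R G"
      then obtain u where "u \<in> R" "to_fract x * \<phi> = to_fract u"
        using x by (auto simp: I_def)
      then have "to_fract (a * x) * \<phi> = to_fract (a * u)" "a * u \<in> R"
        using R a by (auto simp: mult.assoc is_subalgebra_def)
      then show "to_fract (a * x) * \<phi> \<in> to_fract ` R" by (simp only: imageI)
    qed
  qed
  moreover have "G \<subseteq> I"
    using mult generators_in_generated_subalgebra[of G] by (auto simp: I_def R_def)
  ultimately have m: "generated_ideal R G \<subseteq> I"
    unfolding generated_ideal_def by (intro hull_minimal)
  have "local_cohomology1_scale R G a X = cech_B1 R G"
    if a: "a \<in> generated_ideal R G" and X: "X \<in> local_cohomology1 R G" for a X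
  proof -
    obtain \<phi> where \<phi>: "\<phi> \<in> punctured_sections R G"
      and X': "X = (\<lambda>g. if g \<in> G then \<phi> else 0) +o cech_B1 R G"
      using X unfolding local_cohomology1_def cech_Z1_eq[OF assms(1)] by auto
    have aI: "a \<in> R" "to_fract a * \<phi> \<in> to_fract ` R"
      using a m \<phi> by (auto simp: I_def)
    have "local_cohomology1_scale R G a X
        = (\<lambda>g. to_fract a * (if g \<in> G then \<phi> else 0)) +o cech_B1 R G"
      unfolding X' using R R0 aI(1)
      by (intro local_cohomology1_scale_coset) (auto simp: is_subalgebra_def)
    also have "(\<lambda>g. to_fract a * (if g \<in> G then \<phi> else 0))
        = (\<lambda>g. if g \<in> G then to_fract a * \<phi> else 0)"
      by auto
    finally show ?thesis
      using aI(2) by (simp add: coset_cech_B1[OF R] cech_B1_iff[OF assms(1)])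
  qed
  then show ?thesis
    by (auto simp: buchsbaum_def R_def)
qed

lemma to_fract_power: "to_fract (x ^ k) = to_fract x ^ k"
  by (induction k) simp_all

text \<open>
  Comparing coefficients in \<open>a t\<^sup>L = b s\<^sup>K\<close> shows that \<open>s\<^sup>K\<close> divides \<open>a\<close>.
\<close>

lemma fraction_with_two_denominators:
  fixes \<phi> :: "'k::field poly poly fract"
  assumes "\<phi> = to_fract a / to_fract (mon K 0)" "\<phi> = to_fract b / to_fract (mon 0 L)"
  obtains p where "\<phi> = to_fract p" "a = p * mon K 0" "b = p * mon 0 L"
proof -
  have "to_fract (a * mon 0 L) = to_fract (b * mon K 0)"
    using assms by (simp add: field_simps mon_nonzero)
  then have eq: "a * mon 0 L = b * mon K 0"
    by (simp del: to_fract_mult)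
  have "coeff (coeff a j) i = 0" if "i < K" for i j
  proof -
    have "coeff (coeff (a * mon 0 L) (j + L)) i = coeff (coeff (b * mon K 0) (j + L)) i"
      by (simp add: eq)
    with that show ?thesis by (simp add: coeff_coeff_mult_mon)
  qed
  then have "[:monom 1 K:] dvd a"
    by (simp add: const_poly_dvd_iff monom_1_dvd_iff')
  then obtain p where "a = [:monom 1 K:] * p" by (rule dvdE)
  then have p: "a = p * mon K 0"
    by (simp add: mon_def monom_0 mult.commute)
  with assms(1) have "\<phi> = to_fract p"
    by (simp add: mon_nonzero)
  moreover have "b = p * mon 0 L"
  proof -
    have "b * mon K 0 = (p * mon 0 L) * mon K 0"
      unfolding eq[symmetric] p by (simp only: mult_ac)
    then show ?thesis by (simp add: mon_nonzero)
  qed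
  ultimately show ?thesis using p that by blast
qed

section \<open>Sums of two and three exponents\<close>

locale exponents =
  fixes n r :: nat
  assumes n: "1 \<le> n" and r5: "5 \<le> r" and r: "r \<le> 2 * n + 5"
begin

definition N :: nat where "N = 2 * r + 2 * n - 1"

definition E :: "nat set" where
  "E = {0, r, 2 * r - 2} \<union> {e. odd e \<and> 2 * r - 1 \<le> e \<and> e \<le> N}"

lemma E_basic: "0 \<in> E" "r \<in> E" "2 * r - 2 \<in> E"
  by (auto simp: E_def)

lemma E_odd: "odd e \<Longrightarrow> 2 * r - 1 \<le> e \<Longrightarrow> e \<le> N \<Longrightarrow> e \<in> E"
  by (auto simp: E_def)

lemma E_le: "e \<in> E \<Longrightarrow> e \<le> N"
  using n r5 by (auto simp: E_def N_def)

lemma N_in_E: "N \<in> E"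
  using n r5 by (intro E_odd) (auto simp: N_def)

lemma E_values: "e \<in> E \<Longrightarrow> e = 0 \<or> e = r \<or> 2 * r - 2 \<le> e"
  by (auto simp: E_def)

lemma sumset_2I: "x \<in> E \<Longrightarrow> y \<in> E \<Longrightarrow> z = x + y \<Longrightarrow> z \<in> sumset E 2"
  by (auto simp: numeral_2_eq_2)

lemma sumset_3I: "x \<in> E \<Longrightarrow> y \<in> sumset E 2 \<Longrightarrow> z = x + y \<Longrightarrow> z \<in> sumset E 3"
  by (auto simp: eval_nat_numeral)

lemma even_in_sumset_2:
  assumes "even x" "4 * r - 2 \<le> x" "x \<le> 2 * N"
  shows "x \<in> sumset E 2"
proof (cases "x \<le> 2 * r - 1 + N")
  case True
  then show ?thesis
    using assms r5 by (intro sumset_2I[of "2 * r - 1" "x - (2 * r - 1)"] E_odd) (auto simp: N_def)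
next
  case False
  then show ?thesis
    using assms r5 by (intro sumset_2I[of N "x - N"] E_odd) (auto simp: N_def)
qed

lemma r_even: "even r \<Longrightarrow> r \<le> 2 * n + 4" and r_odd: "odd r \<Longrightarrow> r \<le> 2 * n + 3 \<or> r = 2 * n + 5"
  using r by presburger+

text \<open>
  With \<open>o\<close> for an odd element of \<open>E\<close> that is at least \<open>2 r - 1\<close>,
  the types \<open>r + r + o\<close>, \<open>r + (2 r - 2) + o\<close> (\<open>r\<close> even) or \<open>r + o + o\<close> (\<open>r\<close> odd),
  \<open>(2 r - 2) + (2 r - 2) + o\<close> and \<open>o + o + o\<close> each reach all odd numbers of an interval.  If
  \<open>r \<le> 2 n + 4\<close>, these intervals leave out no odd number.  For \<open>r = 2 n + 5\<close> the number \<open>5 r - 4\<close> falls between two intervals; it is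
  \<open>r + (2 r - 2) + (2 r - 2)\<close>.
\<close>

lemma odd_in_sumset_3:
  assumes "odd x" "4 * r \<le> x" "x \<le> 3 * N"
  shows "x \<in> sumset E 3"
proof -
  have parity: "x \<noteq> 4 * r + 2 * n" "even r \<longrightarrow> x + 2 \<noteq> 5 * r + 2 * n" "odd r \<longrightarrow> x + 3 \<noteq> 5 * r"
    using assms(1) by (auto dest: arg_cong[of _ _ even])
  consider "x + 1 \<le> 4 * r + 2 * n"
    | "even r" "5 * r \<le> x + 3" "x + 3 \<le> 5 * r + 2 * n"
    | "odd r" "5 * r \<le> x + 2" "x + 2 \<le> 5 * r + 4 * n"
    | "x + 4 = 5 * r"
    | "6 * r \<le> x + 5" "x + 5 \<le> 6 * r + 2 * n"
    | "6 * r \<le> x + 3"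
  proof (cases "even r")
    case True
    with r_even have "r \<le> 2 * n + 4" by simp
    with True parity n that show ?thesis by linarith
  next
    case False
    with r_odd have "r \<le> 2 * n + 3 \<or> r = 2 * n + 5" by simp
    with False parity n that show ?thesis by linarith
  qed
  then show ?thesis
  proof cases
    case 1
    with assms r5 show ?thesis
      by (intro sumset_3I[OF E_basic(2) sumset_2I[OF E_basic(2) E_odd[of "x - 2 * r"] refl]])
        (auto simp: N_def)
  next
    case 2
    with assms r5 show ?thesis
      by (intro sumset_3I[OF E_basic(2) sumset_2I[OF E_basic(3) E_odd[of "x - (3 * r - 2)"] refl]])
        (auto simp: N_def)
  next
    case 3
    with assms r5 show ?thesis
      by (intro sumset_3I[OF E_basic(2) even_in_sumset_2[of "x - r"]]) (auto simp: N_def)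
  next
    case 4
    with r5 show ?thesis
      by (intro sumset_3I[OF E_basic(2) sumset_2I[OF E_basic(3) E_basic(3) refl]]) auto
  next
    case 5
    with assms r5 show ?thesis
      by (intro sumset_3I[OF E_basic(3) sumset_2I[OF E_basic(3) E_odd[of "x - (4 * r - 4)"] refl]])
        (auto simp: N_def)
  next
    case 6
    show ?thesis
    proof (cases "x \<le> 2 * r - 1 + 2 * N")
      case True
      with assms 6 r5 show ?thesis
        by (intro sumset_3I[OF E_odd[of "2 * r - 1"] even_in_sumset_2[of "x - (2 * r - 1)"]])
          (auto simp: N_def)
    next
      case False
      with assms 6 r5 show ?thesis
        by (intro sumset_3I[OF N_in_E even_in_sumset_2[of "x - N"]]) (auto simp: N_def)
    qed
  qed
qed

text \<open>
  The upper bound is the largest even number of the form \<open>(2 r - 2) + o + o\<close>.  The intervals come from \<open>0 + o + o\<close>, then \<open>r + (2 r - 2) + o\<close> (\<open>r\<close> odd) or \<open>r + o + o\<close>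
  (\<open>r\<close> even), and \<open>(2 r - 2) + o + o\<close>.  For \<open>r = 2 n + 5\<close> the number \<open>6 r - 6\<close> falls between two
  intervals; it is \<open>3 (2 r - 2)\<close>.
\<close>

lemma even_in_sumset_3:
  assumes "even x" "4 * r \<le> x" "x \<le> 6 * r + 4 * n - 4"
  shows "x \<in> sumset E 3"
proof -
  have parity: "x + 1 \<noteq> 4 * r + 4 * n" "odd r \<longrightarrow> x + 2 \<noteq> 5 * r + 2 * n" "x + 5 \<noteq> 6 * r"
    "even r \<longrightarrow> x + 1 \<noteq> 5 * r + 4 * n"
    using assms(1) by (auto dest: arg_cong[of _ _ even])
  consider "x + 2 \<le> 4 * r + 4 * n"
    | "6 * r \<le> x + 4"
    | "odd r" "5 * r \<le> x + 3" "x + 3 \<le> 5 * r + 2 * n"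
    | "x + 6 = 6 * r"
    | "even r" "5 * r \<le> x + 2" "x + 2 \<le> 5 * r + 4 * n"
  proof (cases "even r")
    case True
    with r_even have "r \<le> 2 * n + 4" by simp
    with True parity n that show ?thesis by linarith
  next
    case False
    with r_odd have "r \<le> 2 * n + 3 \<or> r = 2 * n + 5" by simp
    with False parity n that show ?thesis by linarith
  qed
  then show ?thesis
  proof cases
    case 1
    with assms r5 show ?thesis
      by (intro sumset_3I[OF E_basic(1) even_in_sumset_2[of x]]) (auto simp: N_def)
  next
    case 2
    with assms r5 show ?thesis
      by (intro sumset_3I[OF E_basic(3) even_in_sumset_2[of "x - (2 * r - 2)"]]) (auto simp: N_def)
  next
    case 3
    with assms r5 show ?thesis
      by (intro sumset_3I[OF E_basic(2) sumset_2I[OF E_basic(3) E_odd[of "x - (3 * r - 2)"] refl]])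
        (auto simp: N_def)
  next
    case 4
    with r5 show ?thesis
      by (intro sumset_3I[OF E_basic(3) sumset_2I[OF E_basic(3) E_basic(3) refl]]) auto
  next
    case 5
    with assms r5 show ?thesis
      by (intro sumset_3I[OF E_basic(2) even_in_sumset_2[of "x - r"]]) (auto simp: N_def)
  qed
qed

text \<open>
  The nonzero elements of \<open>E\<close> are \<open>r\<close> and numbers that are at least \<open>2 r - 2\<close>.  So a sum with more than
  \<open>k\<close> nonzero terms is either \<open>(k + 1) r\<close> or at least \<open>(k + 2) r - 2\<close>.  This produces the exceptional
  values \<open>2 r\<close> and \<open>3 r\<close>.
\<close>

lemma small_sums:
  assumes "x \<in> sumset E k"
  shows "x \<in> E \<or> x = 2 * r \<or> 3 * r - 2 \<le> x" (is ?one)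
    and "x \<in> sumset E 2 \<or> x = 3 * r \<or> 4 * r - 2 \<le> x" (is ?two)
    and "x \<in> sumset E 3 \<or> 4 * r \<le> x" (is ?three)
proof -
  have "?one \<and> ?two \<and> ?three"
    using assms
  proof (induction k arbitrary: x)
    case 0
    then show ?case using E_basic(1) sumset_mono[OF E_basic(1), of 0 0] by auto
  next
    case (Suc k)
    then obtain e y where x: "x = e + y" and e: "e \<in> E" and y: "y \<in> sumset E k" by auto
    note IH = Suc.IH[OF y]
    show ?case
    proof (cases "e = 0")
      case True
      with x IH show ?thesis by simp
    next
      case False
      then have "e = r \<or> 2 * r - 2 \<le> e"
        using E_values[OF e] by auto
      moreover have "y \<in> E \<Longrightarrow> y = 0 \<or> y = r \<or> 2 * r - 2 \<le> y"
        by (rule E_values)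
      moreover have "y \<in> E \<Longrightarrow> x \<in> sumset E 2" "y \<in> sumset E 2 \<Longrightarrow> x \<in> sumset E 3"
        using x e by (auto intro: sumset_2I sumset_3I)
      ultimately show ?thesis using IH x e r5 by auto
    qed
  qed
  then show ?one ?two ?three by blast+
qed

section \<open>The saturated semigroup and its single gap\<close>

text \<open>
  The pairs \<open>(d, j)\<close> for which the monomial of degree \<open>d N\<close> with \<open>t\<close>-exponent \<open>j\<close> may occur in a section
  on the punctured spectrum.  The first condition comes from the denominator \<open>s\<^sup>N\<close>, the second from \<open>t\<^sup>N\<close>:
  the even numbers together with the numbers from \<open>2 n + 1\<close> on are the numerical semigroup generated
  by \<open>N - E\<close>.
\<close>

definition saturation :: "nat \<Rightarrow> nat \<Rightarrow> bool" where
  "saturation d j \<longleftrightarrow> (\<exists>k. j \<in> sumset E k)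
     \<and> (\<exists>i. i + j = d * N \<and> (even i \<or> 2 * n + 1 \<le> i))"

text \<open>
  In degree 3, sums below \<open>4 r\<close> need at most three terms, and from \<open>4 r\<close> on saturation
  allows exactly the odd numbers up to \<open>3 N\<close> and the even numbers up to \<open>6 r + 4 n - 4\<close>.  In the induction step, subtract the exponent \<open>N\<close> whenever the remainder
  is at least \<open>4 r\<close>, where every number is a sum of elements of \<open>E\<close>; otherwise three terms suffice.
\<close>

lemma saturation_ge_3:
  assumes "saturation d j" "3 \<le> d"
  shows "j \<in> sumset E d"
  using assms(2,1)
proof (induction d arbitrary: j rule: dec_induct)
  case base
  then obtain i k where k: "j \<in> sumset E k" and i: "i + j = 3 * N" "even i \<or> 2 * n + 1 \<le> i"
    by (auto simp: saturation_def)
  show ?case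
  proof (cases "4 * r \<le> j")
    case True
    have "odd (3 * N)" using r5 by (auto simp: N_def)
    then have "odd (i + j)" using i(1) by metis
    then consider "odd j" | "even j" "odd i" by auto
    then show ?thesis
    proof cases
      case 1
      with True i show ?thesis by (intro odd_in_sumset_3) auto
    next
      case 2
      with True i show ?thesis by (intro even_in_sumset_3) (auto simp: N_def)
    qed
  qed (use small_sums(3)[OF k] in auto)
next
  case (step d)
  then obtain i k where k: "j \<in> sumset E k" and i: "i + j = Suc d * N" "even i \<or> 2 * n + 1 \<le> i"
    by (auto simp: saturation_def)
  \<comment> \<open>The interval has length \<open>N\<close>, so that translates by multiples of \<open>N\<close> cover all larger numbers.\<close>
  have window: "x \<in> sumset E 3" if "4 * r \<le> x" "x < 4 * r + N" for x
  proof (cases "even x")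
    case True
    with that n r5 show ?thesis by (intro even_in_sumset_3) (auto simp: N_def)
  next
    case False
    with that n r5 show ?thesis by (intro odd_in_sumset_3) (auto simp: N_def)
  qed
  have tail: "\<exists>k. x \<in> sumset E k" if "4 * r \<le> x" for x
    using that
  proof (induction x rule: less_induct)
    case (less x)
    show ?case
    proof (cases "x < 4 * r + N")
      case False
      have "0 < N" using r5 by (simp add: N_def)
      then have "x - N < x" "4 * r \<le> x - N" using False r5 by linarith+
      then obtain k where "x - N \<in> sumset E k"
        using less.IH[of "x - N"] by auto
      then have "N + (x - N) \<in> sumset E (Suc k)"
        using N_in_E by auto
      moreover have "N + (x - N) = x" using False by simp
      ultimately show ?thesis by metis
    qed (use window less in blast)
  qed
  show ?case
  proof (cases "j < 4 * r + N")
    case True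
    then have "j \<in> sumset E 3"
      using window[of j] small_sums(3)[OF k] by auto
    then show ?thesis
      using sumset_mono[OF E_basic(1), of j 3 "Suc d"] step.hyps by (simp del: sumset.simps)
  next
    case False
    then have "i + (j - N) = d * N" "4 * r \<le> j - N"
      using i(1) by simp_all
    then have "saturation d (j - N)"
      using i(2) tail[of "j - N"] unfolding saturation_def by blast
    then have "N + (j - N) \<in> sumset E (Suc d)"
      using step.IH N_in_E by auto
    with False show ?thesis by simp
  qed
qed

text \<open>
  As \<open>N\<close> is odd, in degree 1 the second condition of saturation removes the exceptional value \<open>2 r\<close>, and
  all larger even numbers.  In degree 2 it does not remove \<open>3 r\<close>.
\<close>

lemma saturation_cases:
  assumes "saturation d j"
  shows "j \<in> sumset E d \<or> d = 2 \<and> j = 3 * r"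
proof -
  obtain i k where k: "j \<in> sumset E k" and i: "i + j = d * N" "even i \<or> 2 * n + 1 \<le> i"
    using assms by (auto simp: saturation_def)
  have oddN: "odd N" using r5 by (auto simp: N_def)
  consider "d = 0" | "d = 1" | "d = 2" | "3 \<le> d" by linarith
  then show ?thesis
  proof cases
    case 1
    with i show ?thesis by simp
  next
    case 2
    have "j \<in> E"
    proof (rule ccontr)
      assume "j \<notin> E"
      then have ge: "2 * r - 1 \<le> j" using small_sums(1)[OF k] r5 by auto
      then have "even j" using \<open>j \<notin> E\<close> i 2 E_odd[of j] by auto
      then have "odd i" using i(1) 2 oddN by (metis even_add mult_1)
      then show False using i ge 2 r5 by (auto simp: N_def)
    qed
    with 2 show ?thesis by auto
  next
    case 3
    have "j \<in> sumset E 2" if ge: "4 * r - 2 \<le> j"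
    proof (cases "even j")
      case True
      with ge i 3 show ?thesis by (intro even_in_sumset_2) auto
    next
      case False
      then have "odd i" using i(1) 3 by (metis even_add even_mult_iff even_numeral)
      with False ge i 3 r5 show ?thesis
        by (intro sumset_2I[OF E_basic(3) E_odd[of "j - (2 * r - 2)"]]) (auto simp: N_def)
    qed
    then show ?thesis using small_sums(2)[OF k] 3 by auto
  next
    case 4
    with saturation_ge_3 assms show ?thesis by blast
  qed
qed

text \<open>
  The numbers that are even or at least \<open>2 n + 1\<close> are closed under addition and contain \<open>N - e\<close> for
  \<open>e \<in> E\<close>: this number is even for odd \<open>e\<close>, and an even \<open>e\<close> is at most \<open>2 r - 2\<close>.
\<close>

lemma co_exponent:
  assumes "i + j = d * N" "j \<in> sumset E d"
  shows "even i \<or> 2 * n + 1 \<le> i"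
  using assms
proof (induction d arbitrary: i j)
  case (Suc d)
  then obtain e y where j: "j = e + y" and e: "e \<in> E" and y: "y \<in> sumset E d" by auto
  have "y \<le> d * N" using y
    by (induction d arbitrary: y) (auto intro!: add_mono E_le)
  then obtain i' where i': "i' + y = d * N" by (metis le_add_diff_inverse2)
  have "i = i' + (N - e)" using Suc.prems(1) j i' E_le[OF e] by auto
  moreover have "even (N - e) \<or> 2 * n + 1 \<le> N - e"
    using e n r5 by (auto simp: E_def N_def)
  ultimately show ?case using Suc.IH[OF i' y] by auto
qed simp

text \<open>
  Adding a generator keeps a pair saturated, and takes the only possible gap from degree 2 to degree 3,
  where there are no gaps.
\<close>

lemma saturation_generator:
  assumes "saturation d j" "e \<in> E"
  shows "e + j \<in> sumset E (Suc d)"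
  using saturation_cases[OF assms(1)]
proof
  assume "j \<in> sumset E d"
  with assms(2) show ?thesis by auto
next
  assume *: "d = 2 \<and> j = 3 * r"
  obtain k i where ki: "j \<in> sumset E k" "i + j = d * N" "even i \<or> 2 * n + 1 \<le> i"
    using assms(1) by (auto simp: saturation_def)
  have "even (N - e) \<or> 2 * n + 1 \<le> N - e"
    using co_exponent[of "N - e" e "Suc 0"] assms(2) E_le[OF assms(2)] by (auto simp: sumset_1)
  with ki have "even (i + (N - e)) \<or> 2 * n + 1 \<le> i + (N - e)" by auto
  moreover have "i + (N - e) + (e + j) = Suc d * N"
    using ki(2) E_le[OF assms(2)] by simp
  moreover have "e + j \<in> sumset E (Suc k)" using ki(1) assms(2) by auto
  ultimately have "saturation (Suc d) (e + j)"
    unfolding saturation_def by blast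
  with * show ?thesis by (intro saturation_ge_3) auto
qed

text \<open>
  A sum of two elements of \<open>E\<close> that equals \<open>3 r\<close> has a summand \<open>0\<close> or \<open>r\<close>, since \<open>2 (2 r - 2) > 3 r\<close>.
  The summand \<open>r\<close> is impossible: \<open>2 r\<close> is even and above the largest even element \<open>2 r - 2\<close>.
\<close>

lemma three_r_in_sumset_2_iff: "3 * r \<in> sumset E 2 \<longleftrightarrow> odd r \<and> r + 1 \<le> 2 * n"
proof
  assume "3 * r \<in> sumset E 2"
  then obtain x y where xy: "x \<in> E" "y \<in> E" "3 * r = x + y"
    by (auto simp: numeral_2_eq_2)
  from E_values[OF xy(1)] E_values[OF xy(2)]
  have "y = 3 * r \<or> x = 3 * r \<or> y = 2 * r \<or> x = 2 * r"
    using xy(3) r5 by linarith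
  then have "3 * r \<in> E \<or> 2 * r \<in> E"
    using xy(1,2) by blast
  then show "odd r \<and> r + 1 \<le> 2 * n"
    using r5 by (auto simp: E_def N_def)
next
  assume "odd r \<and> r + 1 \<le> 2 * n"
  then show "3 * r \<in> sumset E 2"
    using r5 by (intro sumset_2I[OF E_basic(1) E_odd[of "3 * r"]]) (auto simp: N_def)
qed

lemma saturation_3r: "saturation 2 (3 * r)"
proof -
  have "3 * r \<in> sumset E 3"
    by (intro sumset_3I[OF E_basic(2) sumset_2I[OF E_basic(2) E_basic(2) refl]]) simp
  moreover have "(r + 4 * n - 2) + 3 * r = 2 * N" "2 * n + 1 \<le> r + 4 * n - 2"
    using n r5 by (auto simp: N_def)
  ultimately show ?thesis
    unfolding saturation_def by blast
qed

section \<open>Local cohomology of the monomial ring\<close>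

lemma monomials_eq: "monomials n r = {mon (N - e) e | e. e \<in> E}"
proof -
  have odd: "{e. odd e \<and> 2 * r - 1 \<le> e \<and> e \<le> N} = a_exp r ` {..n}"
  proof (intro equalityI subsetI)
    fix e assume e: "e \<in> {e. odd e \<and> 2 * r - 1 \<le> e \<and> e \<le> N}"
    then have "e = a_exp r ((e + 1) div 2 - r)" "(e + 1) div 2 - r \<le> n"
      using r5 by (auto simp: a_exp_def N_def elim!: oddE)
    then show "e \<in> a_exp r ` {..n}" by blast
  qed (use r5 in \<open>auto simp: a_exp_def N_def\<close>)
  have "{..n} = insert n {..<n}" by auto
  moreover have aN: "a_exp r n = N"
    by (simp add: a_exp_def N_def)
  ultimately have "E = {0, r, 2 * r - 2} \<union> a_exp r ` {..<n} \<union> {N}"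
    unfolding E_def odd by auto
  then have "(\<lambda>e. mon (N - e) e) ` E = monomials n r"
    unfolding monomials_def Let_def aN by auto
  then show ?thesis by auto
qed

lemma punctured_section_is_polynomial:
  fixes \<phi> :: "'k::field poly poly fract"
  assumes "\<phi> \<in> punctured_sections (semigroup_ring (graded_monoid N E)) (monomials n r)"
  obtains p where "\<phi> = to_fract p"
    and "\<And>i j. (i, j) \<in> support p \<Longrightarrow> \<exists>d. i + j = d * N \<and> saturation d j"
proof -
  let ?R = "semigroup_ring (graded_monoid N E) :: 'k poly poly set"
  have "mon N 0 \<in> (monomials n r :: 'k poly poly set)"
    "mon 0 N \<in> (monomials n r :: 'k poly poly set)"
    using E_basic(1) N_in_E unfolding monomials_eq by force+
  then have "\<phi> \<in> localization ?R (mon N 0)" "\<phi> \<in> localization ?R (mon 0 N)"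
    using assms by (auto simp only: punctured_sections_def)
  then obtain a b k l where ab: "a \<in> ?R" "b \<in> ?R"
    "\<phi> = to_fract a / to_fract (mon N 0) ^ k" "\<phi> = to_fract b / to_fract (mon 0 N) ^ l"
    unfolding localization_def mem_Collect_eq by metis
  then have "\<phi> = to_fract a / to_fract (mon (k * N) 0)" "\<phi> = to_fract b / to_fract (mon 0 (l * N))"
    by (simp_all add: mon_power flip: to_fract_power)
  then obtain p where p: "\<phi> = to_fract p" "a = p * mon (k * N) 0" "b = p * mon 0 (l * N)"
    by (rule fraction_with_two_denominators)
  have "\<exists>d. i + j = d * N \<and> saturation d j" if ij: "(i, j) \<in> support p" for i j
  proof -
    have "(i + k * N, j) \<in> graded_monoid N E"
      using ab(1) support_mult_mon[OF ij, of "k * N" 0] by (auto simp: p semigroup_ring_def)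
    then obtain c where c: "i + k * N + j = c * N" "j \<in> sumset E c"
      by (auto simp: graded_monoid_def)
    have "(i, j + l * N) \<in> graded_monoid N E"
      using ab(2) support_mult_mon[OF ij, of 0 "l * N"] by (auto simp: p semigroup_ring_def)
    then have "even i \<or> 2 * n + 1 \<le> i"
      using co_exponent by (auto simp: graded_monoid_def)
    \<comment> \<open>Here \<open>k \<le> c\<close> because \<open>k N \<le> c N\<close> and \<open>N > 0\<close>, so no subtraction truncates.\<close>
    moreover have "i + j = (c - k) * N"
      using c(1) by (simp add: diff_mult_distrib)
    ultimately show ?thesis
      using c(2) unfolding saturation_def by blast
  qed
  with p(1) that show ?thesis by blast
qed

lemma generated_ring:
  "generated_subalgebra (monomials n r) = (semigroup_ring (graded_monoid N E) :: 'k::field poly poly set)"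
  unfolding monomials_eq by (rule generated_subalgebra_monomials) (rule E_le)

lemma monomials_nonempty: "monomials n r \<noteq> {}"
  by (auto simp: monomials_def Let_def)

lemma buchsbaum_monomials: "buchsbaum (monomials n r :: 'k::field poly poly set)"
proof (rule buchsbaumI[OF monomials_nonempty], unfold generated_ring)
  let ?R = "semigroup_ring (graded_monoid N E) :: 'k poly poly set"
  fix g :: "'k poly poly" and \<phi>
  assume "g \<in> monomials n r" and \<phi>: "\<phi> \<in> punctured_sections ?R (monomials n r)"
  then obtain e where e: "e \<in> E" "g = mon (N - e) e" unfolding monomials_eq by auto
  obtain p where p: "\<phi> = to_fract p"
    "\<And>i j. (i, j) \<in> support p \<Longrightarrow> \<exists>d. i + j = d * N \<and> saturation d j"
    using punctured_section_is_polynomial[OF \<phi>] by blast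
  have "(i, j) \<in> graded_monoid N E" if "(i, j) \<in> support (g * p)" for i j
  proof -
    from that support_mult[of g p] obtain i' j' where ij: "(i', j') \<in> support p"
      "i = N - e + i'" "j = e + j'"
      by (auto simp: e support_mon)
    with p(2) obtain d where "i' + j' = d * N" "saturation d j'" by blast
    then show ?thesis
      using ij saturation_generator[OF _ e(1)] E_le[OF e(1)]
      by (auto simp: graded_monoid_def intro!: exI[of _ "Suc d"] simp del: sumset.simps)
  qed
  then have "g * p \<in> ?R" by (auto simp: semigroup_ring_def)
  then show "to_fract g * \<phi> \<in> to_fract ` ?R"
    by (auto simp: p simp flip: to_fract_mult)
qed

text \<open>
  The monomial \<open>w\<close> with \<open>t\<close>-exponent \<open>3 r\<close> in degree 2 is a section because \<open>g w \<in> R\<close> for every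
  generator \<open>g\<close>.  It therefore obstructs the Cohen-Macaulay property unless it lies in \<open>R\<close>.
\<close>

lemma cohen_macaulay_monomials_iff:
  "cohen_macaulay (monomials n r :: 'k::field poly poly set) \<longleftrightarrow> odd r \<and> r + 1 \<le> 2 * n"
proof -
  let ?R = "semigroup_ring (graded_monoid N E) :: 'k poly poly set"
  have N0: "0 < N" using r5 by (simp add: N_def)
  have "punctured_sections ?R (monomials n r) \<subseteq> to_fract ` ?R \<longleftrightarrow> 3 * r \<in> sumset E 2"
  proof
    assume 3: "3 * r \<in> sumset E 2"
    show "punctured_sections ?R (monomials n r) \<subseteq> to_fract ` ?R"
    proof
      fix \<phi> assume \<phi>: "\<phi> \<in> punctured_sections ?R (monomials n r)"
      obtain p where p: "\<phi> = to_fract p"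
        "\<And>i j. (i, j) \<in> support p \<Longrightarrow> \<exists>d. i + j = d * N \<and> saturation d j"
        using punctured_section_is_polynomial[OF \<phi>] by blast
      have "p \<in> ?R"
        using p(2) saturation_cases 3 unfolding semigroup_ring_def graded_monoid_def by blast
      with p(1) show "\<phi> \<in> to_fract ` ?R" by blast
    qed
  next
    assume sub: "punctured_sections ?R (monomials n r) \<subseteq> to_fract ` ?R"
    have le: "3 * r \<le> 2 * N" using r5 by (simp add: N_def)
    let ?w = "mon (2 * N - 3 * r) (3 * r) :: 'k poly poly"
    have "to_fract ?w \<in> localization ?R g" if g: "g \<in> monomials n r" for g :: "'k poly poly"
    proof -
      obtain e where e: "e \<in> E" "g = mon (N - e) e"
        using g unfolding monomials_eq by auto
      have "(N - e + (2 * N - 3 * r), e + 3 * r) \<in> graded_monoid N E"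
        using saturation_generator[OF saturation_3r e(1)] E_le[OF e(1)] le
        by (auto simp: graded_monoid_def intro!: exI[of _ "Suc 2"] simp del: sumset.simps)
      then have "g * ?w \<in> ?R"
        by (simp add: e mon_mult support_mon semigroup_ring_def)
      moreover have "to_fract ?w = to_fract (g * ?w) / to_fract g ^ 1"
        by (simp add: e mon_nonzero)
      ultimately show ?thesis unfolding localization_def by blast
    qed
    then have "to_fract ?w \<in> to_fract ` ?R" using sub by (auto simp: punctured_sections_def)
    then have "?w \<in> ?R" by auto
    then obtain d where "2 * N = d * N" "3 * r \<in> sumset E d"
      using le by (auto simp: semigroup_ring_def support_mon graded_monoid_def)
    with N0 show "3 * r \<in> sumset E 2" by auto
  qed
  then show ?thesis
    by (simp add: cohen_macaulay_iff[OF monomials_nonempty] generated_ring three_r_in_sumset_2_iff)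
qed

end

theorem theorem1p1:
  fixes n r :: nat and M :: "'k::field poly poly set"
  assumes "1 \<le> n" and "5 \<le> r" and "r \<le> 2 * n + 5"
    and "M = monomials n r"
  shows "(odd r \<and> 2 * n \<ge> r + 1 \<longrightarrow> cohen_macaulay M) \<and>
         (odd r \<and> 2 * n < r + 1 \<longrightarrow> \<not> cohen_macaulay M \<and> buchsbaum M) \<and>
         (even r \<longrightarrow> \<not> cohen_macaulay M \<and> buchsbaum M)"
proof -
  interpret exponents n r
    using assms by unfold_locales
  show ?thesis
    using buchsbaum_monomials cohen_macaulay_monomials_iff unfolding assms(4) by auto
qed

end
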